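(* Let $D\subset\mathbf{R}^d$ be open and bounded, $\mathcal X\subset\overline D$, and let $J:\Xi\subset\wp(D)\to\mathbf{R}$ be a shape function whose shape derivative at $\Omega\in\Xi$ has the form $$dJ(\Omega)(X)=\int_{\mathcal X}\mathbf S_1:\partial X+\mathbf S_0\cdot X\,dx$$ with $\mathbf S_1\in L_1(\mathcal X,\mathbf{R}^{d,d})$ and $\mathbf S_0\in L_1(\mathcal X,\mathbf{R}^d)$. Let $\sigma>0$ and let $\phi\in C^1(\mathbf{R})$ be such that $k(x,y):=\phi_\sigma(|x-y|^2)$, where $\phi_\sigma(r):=\phi(r/\sigma)$, is a reproducing kernel on $\mathcal X$ with reproducing kernel Hilbert space $\mathcal H(\mathcal X)$. Let $[\mathcal H(\mathcal X)]^d$ be the vector-valued reproducing kernel Hilbert space of the radial kernel $K(x,y)=\phi_\sigma(|x-y|^2)I$, and assume $dJ(\Omega)\in([\mathcal H(\mathcal X)]^d)^*$. Then the gradient $\nabla^\sigma J(\Omega)$ of $J$ at $\Omega$ in $[\mathcal H(\mathcal X)]^d$ is given pointwise, for $y\in\mathcal X$, by $$\nabla^\sigma J(\Omega)(y)=\int_{\mathcal X}\left(\phi_\sigma(|x-y|^2)\,\mathbf S_0(x)+\frac{2}{\sigma}\phi_\sigma'(|x-y|^2)\,\mathbf S_1(x)(x-y)\right)dx,$$ where $\phi_\sigma'(r):=\phi'(r/\sigma)$.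
   Context: $\wp(D)$ is the power set of $D$; $\partial X$ is the Jacobian of $X$, and $A:B=\sum_{ij}A_{ij}B_{ij}$; $I$ is the $d\times d$ identity matrix. A function $k:\mathcal X\times\mathcal X\to\mathbf{R}$ is a reproducing kernel for a real Hilbert space $\mathcal H(\mathcal X)$ of functions $\mathcal X\to\mathbf{R}$ if $k(x,\cdot)\in\mathcal H(\mathcal X)$ and $(k(x,\cdot),f)_{\mathcal H(\mathcal X)}=f(x)$ for all $x\in\mathcal X$, $f\in\mathcal H(\mathcal X)$. The space $[\mathcal H(\mathcal X)]^d$ carries the inner product $(f,g)=\sum_{i=1}^d(f_i,g_i)_{\mathcal H(\mathcal X)}$, and $K=kI$ is its reproducing kernel: $K(x,\cdot)a\in[\mathcal H(\mathcal X)]^d$ and $(K(x,\cdot)a,f)=a\cdot f(x)$. The assumption $dJ(\Omega)\in([\mathcal H(\mathcal X)]^d)^*$ means that the integral formula for $dJ(\Omega)(X)$ is well defined for every $X\in[\mathcal H(\mathcal X)]^d$ (in particular the, possibly weak, derivatives exist) and defines a continuous linear functional there. The gradient $\nabla^\sigma J(\Omega)\in[\mathcal H(\mathcal X)]^d$ is defined by $(\nabla^\sigma J(\Omega),\varphi)=dJ(\Omega)(\varphi)$ for all $\varphi\in[\mathcal H(\mathcal X)]^d$. Note the convention that $\phi_\sigma'$ denotes $\phi'(\cdot/\sigma)$, not the derivative of $\phi_\sigma$. *)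

theory Defs
  imports "HOL-Analysis.Analysis"
begin

section \<open>Smooth, compactly supported functions\<close>

text \<open>In finite dimension, being \<open>C\<^sup>n\<^sup>+\<^sup>1\<close> amounts to being (Frechet) differentiable with all
  directional derivatives \<open>C\<^sup>n\<close>.\<close>

fun C_order :: "nat \<Rightarrow> ('a::euclidean_space \<Rightarrow> 'b::real_normed_vector) \<Rightarrow> bool" where
  "C_order 0 f = continuous_on UNIV f"
| "C_order (Suc n) f =
    (\<exists>f'. (\<forall>x. (f has_derivative f' x) (at x)) \<and> (\<forall>h. C_order n (\<lambda>x. f' x h)))"

text \<open>\<open>C\<^sub>c\<^sup>\<infinity>(U)\<close>, each function being extended by zero to the whole space.\<close>

definition C_c_infinity :: "'a::euclidean_space set \<Rightarrow> ('a \<Rightarrow> 'b::real_normed_vector) set" where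
  "C_c_infinity U =
    {f. (\<forall>n. C_order n f) \<and> compact (closure {x. f x \<noteq> 0}) \<and> closure {x. f x \<noteq> 0} \<subseteq> U}"


section \<open>Jacobians\<close>

definition locally_integrable :: "'a::euclidean_space set \<Rightarrow> ('a \<Rightarrow> 'b::euclidean_space) \<Rightarrow> bool" where
  "locally_integrable U f \<longleftrightarrow> (\<forall>K. compact K \<and> K \<subseteq> U \<longrightarrow> set_integrable lebesgue K f)"

definition weak_jacobian ::
  "(real^'n) set \<Rightarrow> (real^'n \<Rightarrow> real^'n) \<Rightarrow> (real^'n \<Rightarrow> real^'n^'n) \<Rightarrow> bool" where
  "weak_jacobian U F G \<longleftrightarrow>
    locally_integrable U F \<and> locally_integrable U G \<and>
    (\<forall>\<psi> \<in> C_c_infinity U. \<forall>i j.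
      (LINT x:U|lebesgue. F x $ i * frechet_derivative \<psi> (at x) (axis j 1)) =
      - (LINT x:U|lebesgue. G x $ i $ j * \<psi> x))"

text \<open>The set \<open>X\<close> need not be open. Weak derivatives only make sense in its interior; at the
  remaining points of \<open>X\<close> (a null set in the usual situations) the derivative is the classical one
  relative to \<open>X\<close>. Only the values of \<open>F\<close> on \<open>X\<close> matter, and \<open>G\<close> is determined almost everywhere
  on \<open>X\<close>: at density points of \<open>X\<close> the derivative relative to \<open>X\<close> is unique.\<close>

definition jacobian_on ::
  "(real^'n) set \<Rightarrow> (real^'n \<Rightarrow> real^'n) \<Rightarrow> (real^'n \<Rightarrow> real^'n^'n) \<Rightarrow> bool" where
  "jacobian_on X F G \<longleftrightarrow>
    weak_jacobian (interior X) F G \<and>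
    (AE x in lebesgue. x \<in> X - interior X \<longrightarrow>
       (F has_derivative (\<lambda>h. G x *v h)) (at x within X))"

definition jacobian :: "(real^'n) set \<Rightarrow> (real^'n \<Rightarrow> real^'n) \<Rightarrow> real^'n \<Rightarrow> real^'n^'n" where
  "jacobian X F = (SOME G. jacobian_on X F G)"


section \<open>Shape derivatives\<close>

definition is_flow :: "(real^'n \<Rightarrow> real^'n) \<Rightarrow> (real \<Rightarrow> real^'n \<Rightarrow> real^'n) \<Rightarrow> bool" where
  "is_flow V \<Phi> \<longleftrightarrow>
    (\<forall>x. \<Phi> 0 x = x \<and> (\<forall>t. ((\<lambda>s. \<Phi> s x) has_vector_derivative V (\<Phi> t x)) (at t)))"

definition has_shape_derivative ::
  "((real^'n) set \<Rightarrow> real) \<Rightarrow> (real^'n) set set \<Rightarrow> (real^'n) set \<Rightarrow> (real^'n \<Rightarrow> real^'n) \<Rightarrow> real \<Rightarrow> bool"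
where
  "has_shape_derivative J \<Xi> \<Omega> V l \<longleftrightarrow>
    (\<exists>\<Phi>. is_flow V \<Phi> \<and> (\<forall>\<^sub>F t in at_right 0. \<Phi> t ` \<Omega> \<in> \<Xi>) \<and>
         ((\<lambda>t. (J (\<Phi> t ` \<Omega>) - J \<Omega>) / t) \<longlongrightarrow> l) (at_right 0))"

text \<open>The inner product of \<^typ>\<open>real^'n^'n\<close> is the Frobenius product \<open>A : B\<close>.\<close>

definition tensor_integrand ::
  "(real^'n) set \<Rightarrow> (real^'n \<Rightarrow> real^'n^'n) \<Rightarrow> (real^'n \<Rightarrow> real^'n) \<Rightarrow> (real^'n \<Rightarrow> real^'n) \<Rightarrow> real^'n \<Rightarrow> real"
where
  "tensor_integrand X S1 S0 F x = S1 x \<bullet> jacobian X F x + S0 x \<bullet> F x"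

definition tensor_form ::
  "(real^'n) set \<Rightarrow> (real^'n \<Rightarrow> real^'n^'n) \<Rightarrow> (real^'n \<Rightarrow> real^'n) \<Rightarrow> (real^'n \<Rightarrow> real^'n) \<Rightarrow> real"
where
  "tensor_form X S1 S0 F = (LINT x:X|lebesgue. tensor_integrand X S1 S0 F x)"

text \<open>The integral formula makes sense for \<open>F\<close>.\<close>

definition tensor_form_defined ::
  "(real^'n) set \<Rightarrow> (real^'n \<Rightarrow> real^'n^'n) \<Rightarrow> (real^'n \<Rightarrow> real^'n) \<Rightarrow> (real^'n \<Rightarrow> real^'n) \<Rightarrow> bool"
where
  "tensor_form_defined X S1 S0 F \<longleftrightarrow>
    (\<exists>G. jacobian_on X F G) \<and> set_integrable lebesgue X (tensor_integrand X S1 S0 F)"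


section \<open>Reproducing kernel Hilbert spaces\<close>

text \<open>A Hilbert space of real functions on \<open>X\<close> is a Hilbert space \<^typ>\<open>'h\<close> together with a linear
  evaluation map \<open>ev\<close>, such that distinct elements are distinct functions on \<open>X\<close>.
  The values of \<open>ev h\<close> outside \<open>X\<close> are irrelevant.\<close>

definition function_space_on ::
  "'a set \<Rightarrow> ('h::{real_inner, complete_space} \<Rightarrow> 'a \<Rightarrow> real) \<Rightarrow> bool" where
  "function_space_on X ev \<longleftrightarrow>
    (\<forall>x\<in>X. linear (\<lambda>f. ev f x)) \<and> (\<forall>f g. (\<forall>x\<in>X. ev f x = ev g x) \<longrightarrow> f = g)"

definition reproducing_kernel_on ::
  "'a set \<Rightarrow> ('h::{real_inner, complete_space} \<Rightarrow> 'a \<Rightarrow> real) \<Rightarrow> ('a \<Rightarrow> 'a \<Rightarrow> real) \<Rightarrow> bool" where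
  "reproducing_kernel_on X ev k \<longleftrightarrow>
    (\<forall>x\<in>X. \<exists>h. (\<forall>y\<in>X. ev h y = k x y) \<and> (\<forall>f. h \<bullet> f = ev f x))"

text \<open>The space \<open>[H(X)]\<^sup>d\<close> is \<^typ>\<open>'h^'n\<close>, whose inner product is the sum of those of the
  components; its elements are viewed as vector fields as follows.\<close>

definition vec_eval :: "('h \<Rightarrow> 'a \<Rightarrow> real) \<Rightarrow> 'h^'n \<Rightarrow> 'a \<Rightarrow> real^'n" where
  "vec_eval ev f x = (\<chi> i. ev (f $ i) x)"

text \<open>The Riesz representative of a functional.\<close>

definition gradient :: "('v::real_inner \<Rightarrow> real) \<Rightarrow> 'v" where
  "gradient L = (THE g. \<forall>\<phi>. g \<bullet> \<phi> = L \<phi>)"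

definition rescale :: "real \<Rightarrow> (real \<Rightarrow> real) \<Rightarrow> real \<Rightarrow> real" where
  "rescale \<sigma> f r = f (r / \<sigma>)"

end

theory Submission
  imports Defs
begin

text \<open>Let \<open>h\<close> be the kernel section at \<open>y\<close>. Pairing the gradient with the field that has \<open>h\<close> as its
  \<open>i\<close>-th component and zeros elsewhere gives the \<open>i\<close>-th component of the gradient at \<open>y\<close>, so this
  component is the integral formula evaluated at that field. On \<open>X\<close> the field coincides with a
  \<open>C\<^sup>1\<close> field, and what has to be seen is that the chosen Jacobian agrees with the classical one
  almost everywhere on \<open>X\<close>. In the interior of \<open>X\<close> this is the uniqueness of weak derivatives. On
  the rest of \<open>X\<close>, both are derivatives relative to \<open>X\<close>, and such a derivative is unique unless
  \<open>x\<close> is isolated in \<open>X\<close> along some coordinate line, which happens only on a null set.\<close>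

section \<open>Riesz representation\<close>

lemma riesz_representation:
  fixes L :: "'v::{real_inner, complete_space} \<Rightarrow> real"
  assumes "bounded_linear L"
  shows "\<exists>g. \<forall>x. g \<bullet> x = L x"
proof -
  interpret L: bounded_linear L by fact
  \<comment> \<open>The representative is the minimiser of \<open>Q\<close>; minimising sequences are Cauchy by the
    parallelogram law.\<close>
  define Q where "Q x = x \<bullet> x - 2 * L x" for x
  obtain K where K: "\<And>x. \<bar>L x\<bar> \<le> norm x * K"
    using L.bounded by auto
  \<comment> \<open>Completing the square: \<open>Q x\<close> is at least
    \<open>(norm x - K)\<^sup>2 - K\<^sup>2\<close>.\<close>
  have below: "- K\<^sup>2 \<le> Q x" for x
  proof -
    have "0 \<le> (norm x - K)\<^sup>2" by simp
    then show ?thesis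
      using K[of x] by (simp add: Q_def power2_diff power2_norm_eq_inner)
  qed
  define m where "m = Inf (range Q)"
  have bdd: "bdd_below (range Q)"
    using below by (auto intro!: bdd_belowI)
  have m_le: "m \<le> Q x" for x
    unfolding m_def by (rule cInf_lower[OF _ bdd]) simp
  have "\<exists>x. Q x < m + inverse (real (Suc n))" for n
  proof -
    have "Inf (range Q) < m + inverse (real (Suc n))"
      by (simp add: m_def)
    then show ?thesis
      using cInf_less_iff[OF _ bdd] by auto
  qed
  then obtain X where X: "\<And>n. Q (X n) < m + inverse (real (Suc n))"
    by metis
  \<comment> \<open>In the identity below the linear terms cancel; bounding \<open>Q\<close> at the
    midpoint below by \<open>m\<close> leaves only the excesses of \<open>x\<close> and
    \<open>y\<close> over the infimum.\<close>
  have par: "(norm (x - y))\<^sup>2 \<le> 2 * (Q x - m) + 2 * (Q y - m)" for x y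
  proof -
    have "(norm (x - y))\<^sup>2 = 2 * Q x + 2 * Q y - 4 * Q ((1/2) *\<^sub>R (x + y))"
      unfolding Q_def power2_norm_eq_inner
      by (simp add: inner_simps L.scaleR L.add inner_commute algebra_simps)
    then show ?thesis using m_le[of "(1/2) *\<^sub>R (x + y)"] by simp
  qed
  have "Cauchy X"
  proof (rule metric_CauchyI)
    fix e :: real assume "e > 0"
    \<comment> \<open>With excesses below \<open>e\<^sup>2 / 4\<close>, the two terms on the right
      of \<open>par\<close> add up to less than \<open>e\<^sup>2\<close>.\<close>
    then obtain N where N: "inverse (real (Suc N)) < e\<^sup>2 / 4"
      using reals_Archimedean[of "e\<^sup>2 / 4"] by auto
    have small: "Q (X n) - m < e\<^sup>2 / 4" if "n \<ge> N" for n
    proof -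
      have "inverse (real (Suc n)) \<le> inverse (real (Suc N))"
        using that by (simp add: field_simps)
      then show ?thesis using X[of n] N by linarith
    qed
    show "\<exists>M. \<forall>p\<ge>M. \<forall>n\<ge>M. dist (X p) (X n) < e"
    proof (intro exI allI impI)
      fix p n assume "N \<le> p" "N \<le> n"
      then have "(norm (X p - X n))\<^sup>2 < e\<^sup>2"
        using par[of "X p" "X n"] small[of p] small[of n] by simp
      then show "dist (X p) (X n) < e"
        using \<open>e > 0\<close> power2_less_imp_less[of "norm (X p - X n)" e] by (simp add: dist_norm)
    qed
  qed
  then obtain g where g: "X \<longlonglongrightarrow> g"
    using Cauchy_convergent convergent_def by blast
  have "(\<lambda>n. Q (X n)) \<longlonglongrightarrow> Q g"
    unfolding Q_def by (intro tendsto_intros L.tendsto g)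
  moreover have "(\<lambda>n. m + inverse (real (Suc n))) \<longlonglongrightarrow> m + 0"
    by (intro tendsto_intros LIMSEQ_inverse_real_of_nat)
  ultimately have "Q g \<le> m + 0"
    by (rule LIMSEQ_le) (use X less_imp_le in blast)
  then have min: "Q g \<le> Q x" for x
    using m_le[of x] by simp
  have "g \<bullet> x = L x" for x
  proof -
    \<comment> \<open>\<open>c\<close> is the defect at \<open>x\<close>. Moving \<open>g\<close> by
      \<open>- (c * s) *\<^sub>R x\<close> would lower \<open>Q\<close> if \<open>c\<close> were
      nonzero: \<open>s\<close> is so small that the linear term beats the quadratic one, and the
      summand 1 keeps it defined for \<open>x = 0\<close>.\<close>
    define c where "c = g \<bullet> x - L x"
    define s where "s = 1 / (x \<bullet> x + 1)"
    have pos: "x \<bullet> x + 1 > 0" by (simp add: add_nonneg_pos)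
    have "Q (g - a *\<^sub>R x) - Q g = a\<^sup>2 * (x \<bullet> x) - 2 * a * c" for a
      unfolding Q_def c_def L.diff L.scaleR
      by (simp add: inner_simps inner_commute algebra_simps power2_eq_square)
    from this[of "c * s"] have "Q (g - (c * s) *\<^sub>R x) - Q g = c\<^sup>2 * (s * (s * (x \<bullet> x) - 2))"
      by (simp add: algebra_simps power2_eq_square)
    moreover have "s * (x \<bullet> x) - 2 < 0" "s > 0"
      using pos by (simp_all add: s_def field_simps)
    ultimately have "0 \<le> c\<^sup>2 * (s * (s * (x \<bullet> x) - 2))" "s * (s * (x \<bullet> x) - 2) < 0"
      using min[of "g - (c * s) *\<^sub>R x"] by (simp_all add: mult_less_0_iff)
    then have "c = 0"
      using mult_pos_neg[of "c\<^sup>2"] by (metis linorder_not_less zero_less_power2)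
    then show ?thesis by (simp add: c_def)
  qed
  then show ?thesis by blast
qed

text \<open>Riesz gives existence, and testing the difference of two representatives against itself
  gives uniqueness, so the definite description in \<open>gradient\<close> denotes the
  representative.\<close>

lemma gradient_inner:
  fixes L :: "'v::{real_inner, complete_space} \<Rightarrow> real"
  assumes "bounded_linear L"
  shows "gradient L \<bullet> x = L x"
proof -
  obtain g where g: "\<forall>x. g \<bullet> x = L x"
    using riesz_representation[OF assms] by blast
  have "gradient L = g"
    unfolding gradient_def
  proof (rule the_equality)
    show "\<forall>x. g \<bullet> x = L x" by fact
    fix h assume "\<forall>x. h \<bullet> x = L x"
    with g have "(h - g) \<bullet> (h - g) = 0"
      by (simp add: inner_diff_left)
    then show "h = g" by simp
  qed
  with g show ?thesis by simp
qed

section \<open>Bump functions\<close>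

lemma C_order_continuous: "C_order n f \<Longrightarrow> continuous_on UNIV f"
  by (cases n) (auto intro: has_derivative_continuous_on has_derivative_at_withinI)

text \<open>Needed for products: the derivative of a product contains the undifferentiated factors,
  which must have the lower order too.\<close>

lemma C_order_SucD: "C_order (Suc n) f \<Longrightarrow> C_order n f"
proof (induction n arbitrary: f)
  case 0
  then show ?case using C_order_continuous[OF 0] by simp
next
  case (Suc n)
  then obtain f' where f': "\<forall>x. (f has_derivative f' x) (at x)" "\<forall>h. C_order (Suc n) (\<lambda>x. f' x h)"
    by (subst (asm) C_order.simps) blast
  then have "\<forall>h. C_order n (\<lambda>x. f' x h)"
    using Suc.IH by blast
  with f' show ?case by (subst C_order.simps) blast
qed

lemma C_order_const: "C_order n (\<lambda>x. c)"
proof (induction n arbitrary: c)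
  case (Suc n)
  then show ?case
    by (auto intro!: exI[of _ "\<lambda>_ _. 0"])
qed simp

lemma C_order_add:
  "C_order n f \<Longrightarrow> C_order n g \<Longrightarrow> C_order n (\<lambda>x. f x + g x)"
proof (induction n arbitrary: f g)
  case (Suc n)
  then obtain f' g' where "\<forall>x. (f has_derivative f' x) (at x)" "\<forall>h. C_order n (\<lambda>x. f' x h)"
    "\<forall>x. (g has_derivative g' x) (at x)" "\<forall>h. C_order n (\<lambda>x. g' x h)" by auto
  with Suc.IH show ?case
    by (auto intro!: exI[of _ "\<lambda>x h. f' x h + g' x h"] has_derivative_add)
qed (auto intro: continuous_intros)

lemma C_order_mult:
  fixes f g :: "'a::euclidean_space \<Rightarrow> real"
  shows "C_order n f \<Longrightarrow> C_order n g \<Longrightarrow> C_order n (\<lambda>x. f x * g x)"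
proof (induction n arbitrary: f g)
  case (Suc n)
  then obtain f' g' where "\<forall>x. (f has_derivative f' x) (at x)" "\<forall>h. C_order n (\<lambda>x. f' x h)"
    "\<forall>x. (g has_derivative g' x) (at x)" "\<forall>h. C_order n (\<lambda>x. g' x h)" by auto
  with Suc.IH Suc.prems[THEN C_order_SucD] show ?case
    by (auto intro!: exI[of _ "\<lambda>x h. f x * g' x h + f' x h * g x"] has_derivative_mult C_order_add)
qed (auto intro: continuous_intros)

lemma C_order_prod:
  fixes f :: "'i \<Rightarrow> 'a::euclidean_space \<Rightarrow> real"
  assumes "\<And>i. i \<in> I \<Longrightarrow> C_order n (f i)"
  shows "C_order n (\<lambda>x. \<Prod>i\<in>I. f i x)"
  using assms by (induction I rule: infinite_finite_induct) (auto intro!: C_order_const C_order_mult)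

text \<open>The family is closed under differentiation up to linear combinations, whence smoothness.\<close>

definition bump :: "nat \<Rightarrow> real \<Rightarrow> real" where
  "bump k t = (if t > 0 then exp (- inverse t) * inverse t ^ k else 0)"

text \<open>With \<open>u = inverse t\<close> the right limit becomes that of
  \<open>u ^ k / exp u\<close> at infinity; on the left the function is zero.\<close>

lemma bump_tendsto_0: "(bump k \<longlongrightarrow> 0) (at 0)"
proof -
  have "((\<lambda>t. exp (- inverse t) * inverse t ^ k) \<longlongrightarrow> 0) (at_right (0::real))"
    using filterlim_compose[OF tendsto_power_div_exp_0[of k] filterlim_inverse_at_top_right]
    by (simp add: exp_minus field_simps)
  then have "(bump k \<longlongrightarrow> 0) (at_right 0)"
    by (rule Lim_transform_eventually) (auto simp: bump_def eventually_at_filter)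
  moreover have "(bump k \<longlongrightarrow> 0) (at_left 0)"
    by (rule Lim_transform_eventually[OF tendsto_const]) (auto simp: bump_def eventually_at_filter)
  ultimately show ?thesis
    by (simp add: filterlim_split_at_real)
qed

lemma bump_has_field_derivative:
  "(bump k has_real_derivative bump (k + 2) t - real k * bump (k + 1) t) (at t)"
proof -
  consider "t > 0" | "t < 0" | "t = 0" by linarith
  then show ?thesis
  proof cases
    case 1
    have "((\<lambda>t. exp (- inverse t) * inverse t ^ k) has_real_derivative
        bump (k + 2) t - real k * bump (k + 1) t) (at t)"
      using 1 by (auto intro!: derivative_eq_intros simp: bump_def field_simps power2_eq_square)
        (cases k; simp)
    then show ?thesis
      by (rule has_field_derivative_transform_within_open[where S="{0<..}"]) (use 1 in \<open>auto simp: bump_def\<close>)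
  next
    case 2
    have "((\<lambda>t. 0) has_real_derivative bump (k + 2) t - real k * bump (k + 1) t) (at t)"
      using 2 by (simp add: bump_def)
    then show ?thesis
      by (rule has_field_derivative_transform_within_open[where S="{..<0}"]) (use 2 in \<open>auto simp: bump_def\<close>)
  next
    case 3
    \<comment> \<open>At 0 the difference quotient of \<open>bump k\<close> is
      \<open>bump (Suc k)\<close>, whose limit is known.\<close>
    have "((\<lambda>h. (bump k (0 + h) - bump k 0) / h) \<longlongrightarrow> 0) (at 0)"
      by (rule Lim_transform_eventually[OF bump_tendsto_0[of "Suc k"]])
        (auto simp: bump_def eventually_at_filter field_simps)
    then show ?thesis
      using 3 by (simp add: DERIV_def bump_def)
  qed
qed

text \<open>The exponent is kept arbitrary in the induction because differentiation raises it by one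
  and by two. The chain rule only adds the factor \<open>v \<bullet> h\<close>, constant in
  \<open>x\<close>.\<close>

lemma C_order_bump:
  "C_order n (\<lambda>x::'a::euclidean_space. bump k (v \<bullet> x + c))"
proof (induction n arbitrary: k)
  case 0
  have "continuous_on UNIV (bump k)"
    by (meson DERIV_isCont bump_has_field_derivative continuous_at_imp_continuous_on)
  then have "continuous_on UNIV (\<lambda>x. bump k (v \<bullet> x + c))"
    by (rule continuous_on_compose2) (auto intro!: continuous_intros)
  then show ?case by simp
next
  case (Suc n)
  let ?D = "\<lambda>x h. (v \<bullet> h) * bump (k + 2) (v \<bullet> x + c) + (- (v \<bullet> h) * real k) * bump (k + 1) (v \<bullet> x + c)"
  have "((\<lambda>x. bump k (v \<bullet> x + c)) has_derivative ?D x) (at x)" for x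
  proof -
    have "((\<lambda>x. v \<bullet> x + c) has_derivative (\<lambda>h. v \<bullet> h)) (at x)"
      by (auto intro!: derivative_eq_intros)
    from has_derivative_compose[OF this bump_has_field_derivative[unfolded has_field_derivative_def]]
    show ?thesis
      by (simp add: algebra_simps)
  qed
  moreover have "C_order n (\<lambda>x. ?D x h)" for h
    by (intro C_order_add C_order_mult C_order_const Suc.IH)
  ultimately show ?case
    by (subst C_order.simps) (intro exI[of _ ?D] conjI allI)
qed

section \<open>Smooth approximation of the indicator of a box\<close>

lemma bump_0_bounds: "0 \<le> bump 0 t" "bump 0 t \<le> 1"
  by (auto simp: bump_def)

text \<open>For positive \<open>t\<close> and \<open>m\<close> the value is
  \<open>exp (- 1 / (m t))\<close>, whose exponent tends to 0; scaling thus turns the bump into an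
  approximate step function.\<close>

lemma bump_0_scaled_tendsto: "(\<lambda>m. bump 0 (real m * t)) \<longlonglongrightarrow> (if t > 0 then 1 else 0)"
proof (cases "t > 0")
  case True
  have "(\<lambda>m. exp (- (inverse (real m) * inverse t))) \<longlonglongrightarrow> exp (- (0 * inverse t))"
    by (intro tendsto_intros lim_inverse_n)
  then have "(\<lambda>m. exp (- (inverse (real m) * inverse t))) \<longlonglongrightarrow> 1"
    by simp
  \<comment> \<open>The sequences agree only from \<open>m = 1\<close> on: at \<open>m = 0\<close>
    the bump is 0, while \<open>inverse 0 = 0\<close> makes the exponential 1.\<close>
  then have "(\<lambda>m. bump 0 (real m * t)) \<longlonglongrightarrow> 1"
    by (rule Lim_transform_eventually)
      (use True in \<open>auto simp: bump_def eventually_sequentially intro!: exI[of _ 1]\<close>)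
  with True show ?thesis by simp
next
  case False
  then have "bump 0 (real m * t) = 0" for m
    by (simp add: bump_def zero_less_mult_iff)
  with False show ?thesis by simp
qed

text \<open>Each coordinate contributes two scaled bumps, one for each face of the box. The product
  vanishes once a coordinate leaves its open interval, and inside the box every factor tends to
  1.\<close>

lemma smooth_approx_indicator_box:
  fixes a b :: "'a::euclidean_space"
  obtains \<psi> :: "nat \<Rightarrow> 'a \<Rightarrow> real"
  where "\<And>m n. C_order n (\<psi> m)" "\<And>m x. \<bar>\<psi> m x\<bar> \<le> 1" "\<And>m x. x \<notin> box a b \<Longrightarrow> \<psi> m x = 0"
    "\<And>x. (\<lambda>m. \<psi> m x) \<longlonglongrightarrow> indicator (box a b) x"
proof
  \<comment> \<open>The arguments are written as affine functions of \<open>x\<close>, as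
    \<open>C_order_bump\<close> expects; \<open>eq\<close> restores the distances to the
    faces.\<close>
  define \<psi> where "\<psi> m x = (\<Prod>i\<in>Basis. bump 0 ((real m *\<^sub>R i) \<bullet> x + - real m * (a \<bullet> i)) *
    bump 0 ((- real m *\<^sub>R i) \<bullet> x + real m * (b \<bullet> i)))" for m :: nat and x :: 'a
  have eq: "\<psi> m x = (\<Prod>i\<in>Basis. bump 0 (real m * ((x - a) \<bullet> i)) * bump 0 (real m * ((b - x) \<bullet> i)))" for m x
    unfolding \<psi>_def by (intro prod.cong refl) (simp add: inner_simps inner_commute algebra_simps)
  show "C_order n (\<psi> m)" for m n
    unfolding \<psi>_def by (intro C_order_prod C_order_mult C_order_bump)
  have "\<bar>bump 0 s * bump 0 t\<bar> \<le> 1" for s t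
    using mult_mono[OF bump_0_bounds(2)[of s] bump_0_bounds(2)[of t]] bump_0_bounds
    by (simp add: abs_mult)
  then show "\<bar>\<psi> m x\<bar> \<le> 1" for m x
    unfolding eq abs_prod by (intro prod_le_1) auto
  show "\<psi> m x = 0" if x: "x \<notin> box a b" for m x
  proof -
    obtain i where i: "i \<in> Basis" "x \<bullet> i \<le> a \<bullet> i \<or> b \<bullet> i \<le> x \<bullet> i"
      using x by (auto simp: box_def not_less)
    then have "bump 0 (real m * ((x - a) \<bullet> i)) * bump 0 (real m * ((b - x) \<bullet> i)) = 0"
      by (auto simp: bump_def inner_diff_left zero_less_mult_iff)
    with i(1) show ?thesis
      unfolding eq by (intro prod_zero) auto
  qed
  have "(\<lambda>m. \<psi> m x) \<longlonglongrightarrow>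
      (\<Prod>i\<in>Basis. (if (x - a) \<bullet> i > 0 then 1 else 0) * (if (b - x) \<bullet> i > 0 then 1 else 0))" for x
    unfolding eq by (intro tendsto_prod tendsto_mult bump_0_scaled_tendsto)
  moreover have "(\<Prod>i\<in>Basis. (if (x - a) \<bullet> i > 0 then 1 else 0) * (if (b - x) \<bullet> i > 0 then 1 else (0::real))) =
     indicator (box a b) x" for x
  proof (cases "x \<in> box a b")
    case True
    then show ?thesis by (simp add: box_def inner_diff_left)
  next
    case False
    then obtain i where "i \<in> Basis" "x \<bullet> i \<le> a \<bullet> i \<or> b \<bullet> i \<le> x \<bullet> i"
      by (auto simp: box_def not_less)
    with False show ?thesis
      by (auto intro!: bexI[of _ i] simp: inner_diff_left)
  qed
  ultimately show "(\<lambda>m. \<psi> m x) \<longlonglongrightarrow> indicator (box a b) x" for x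
    by simp
qed

section \<open>The fundamental lemma of the calculus of variations\<close>

text \<open>Test with smooth approximations of the indicator of the open box and pass to the limit
  by dominated convergence. Their supports lie in the closed box, a compact subset of
  \<open>U\<close>, and the boundary of the box is a null set.\<close>

lemma integral_cbox_eq_0_if_test:
  fixes g :: "'a::euclidean_space \<Rightarrow> real"
  assumes loc: "locally_integrable U g"
    and test: "\<And>\<psi>. \<psi> \<in> C_c_infinity U \<Longrightarrow> (LINT x:U|lebesgue. g x * \<psi> x) = 0"
    and ab: "cbox a b \<subseteq> U"
  shows "integral (cbox a b) g = 0"
proof -
  obtain \<psi> :: "nat \<Rightarrow> 'a \<Rightarrow> real" where \<psi>: "\<And>m n. C_order n (\<psi> m)" "\<And>m x. \<bar>\<psi> m x\<bar> \<le> 1"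
    "\<And>m x. x \<notin> box a b \<Longrightarrow> \<psi> m x = 0"
    "\<And>x. (\<lambda>m. \<psi> m x) \<longlonglongrightarrow> indicator (box a b) x"
    using smooth_approx_indicator_box[of a b] by blast
  have int: "set_integrable lebesgue (cbox a b) g"
    using loc ab by (auto simp: locally_integrable_def)
  \<comment> \<open>Cutting \<open>g\<close> off outside the closed box gives a globally integrable
    function; as the approximations are bounded by 1, its absolute value is the dominating
    function.\<close>
  define h where "h x = indicator (cbox a b) x * g x" for x
  have h: "integrable lebesgue h"
    using int by (simp add: set_integrable_def h_def[abs_def])
  have \<psi>_meas: "\<psi> m \<in> borel_measurable lebesgue" for m
    using borel_measurable_continuous_onI[OF C_order_continuous[OF \<psi>(1)[of 0 m]]]
    by (simp add: measurable_completion)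
  have "(\<lambda>m. LINT x|lebesgue. h x * \<psi> m x) \<longlonglongrightarrow> (LINT x|lebesgue. h x * indicator (box a b) x)"
  proof (rule integral_dominated_convergence[where w="\<lambda>x. \<bar>h x\<bar>"])
    show "(\<lambda>x. h x * indicator (box a b) x) \<in> borel_measurable lebesgue"
      using h by (intro borel_measurable_times borel_measurable_indicator) auto
    show "(\<lambda>x. h x * \<psi> m x) \<in> borel_measurable lebesgue" for m
      using h \<psi>_meas by (intro borel_measurable_times) auto
    show "AE x in lebesgue. (\<lambda>m. h x * \<psi> m x) \<longlonglongrightarrow> h x * indicator (box a b) x"
      using \<psi>(4) by (intro AE_I2 tendsto_intros)
    show "AE x in lebesgue. norm (h x * \<psi> m x) \<le> \<bar>h x\<bar>" for m
      using \<psi>(2) by (intro AE_I2) (simp add: abs_mult mult_left_le)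
  qed (use h in simp)
  moreover have "(LINT x|lebesgue. h x * \<psi> m x) = 0" for m
  proof -
    have "closure {x. \<psi> m x \<noteq> 0} \<subseteq> cbox a b"
      using \<psi>(3) box_subset_cbox by (intro closure_minimal) (blast intro: closed_cbox)+
    moreover from this have "compact (closure {x. \<psi> m x \<noteq> 0})"
      by (meson bounded_subset bounded_cbox closed_closure compact_eq_bounded_closed)
    ultimately have "\<psi> m \<in> C_c_infinity U"
      using ab \<psi>(1) by (auto simp: C_c_infinity_def)
    moreover have "(\<lambda>x. h x * \<psi> m x) = (\<lambda>x. indicator U x *\<^sub>R (g x * \<psi> m x))"
    proof
      fix x
      show "h x * \<psi> m x = indicator U x *\<^sub>R (g x * \<psi> m x)"
        using ab \<psi>(3)[of x m] box_subset_cbox[of a b]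
        by (cases "x \<in> box a b") (auto simp: h_def indicator_def)
    qed
    ultimately show ?thesis
      using test[of "\<psi> m"] unfolding set_lebesgue_integral_def by simp
  qed
  ultimately have "(LINT x|lebesgue. h x * indicator (box a b) x) = 0"
    by (simp add: LIMSEQ_const_iff)
  moreover have "h x * indicator (box a b) x = indicator (box a b) x * g x" for x
    using box_subset_cbox[of a b] by (auto simp: h_def indicator_def)
  ultimately have "(LINT x:box a b|lebesgue. g x) = 0"
    by (simp add: set_lebesgue_integral_def)
  moreover have "set_integrable lebesgue (box a b) g"
    by (rule set_integrable_subset[OF int]) (auto simp: box_subset_cbox)
  ultimately show ?thesis
    by (simp add: set_lebesgue_integral_eq_integral integral_open_interval)
qed

text \<open>All integrals of \<open>g\<close> over closed boxes in \<open>U\<close> vanish. By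
  Lebesgue differentiation over cubes with corner \<open>x\<close>, almost every value of
  \<open>g\<close> in such a box is a limit of vanishing averages; countably many boxes cover
  \<open>U\<close>.\<close>

lemma fundamental_lemma_calculus_of_variations:
  fixes g :: "'a::euclidean_space \<Rightarrow> real"
  assumes "open U" and loc: "locally_integrable U g"
    and test: "\<And>\<psi>. \<psi> \<in> C_c_infinity U \<Longrightarrow> (LINT x:U|lebesgue. g x * \<psi> x) = 0"
  shows "AE x in lebesgue. x \<in> U \<longrightarrow> g x = 0"
proof -
  have on_cbox: "AE x in lebesgue. x \<in> cbox a b \<longrightarrow> g x = 0" if ab: "cbox a b \<subseteq> U" for a b
  proof -
    \<comment> \<open>The differentiation theorem asks for integrability over every box, hence the
      extension of \<open>g\<close> by zero.\<close>
    define f where "f x = (if x \<in> cbox a b then g x else 0)" for x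
    have g_int: "g integrable_on cbox a b"
      using loc ab by (auto simp: locally_integrable_def intro: set_lebesgue_integral_eq_integral(1))
    then have f_int: "f integrable_on cbox c d" for c d
      unfolding f_def using integrable_restrict_UNIV integrable_on_subcbox by blast
    obtain N where N: "negligible N" "\<And>x e. \<lbrakk>x \<notin> N; 0 < e\<rbrakk> \<Longrightarrow>
        \<exists>d>0. \<forall>h. 0 < h \<and> h < d \<longrightarrow> norm (integral (cbox x (x + h *\<^sub>R One)) f /\<^sub>R h ^ DIM('a) - f x) < e"
      using integrable_ccontinuous_explicit[OF f_int] by blast
    have "g x = 0" if x: "x \<in> box a b" "x \<notin> N" for x
    proof (rule ccontr)
      assume "g x \<noteq> 0"
      moreover have fx: "f x = g x"
        using x(1) box_subset_cbox[of a b] by (auto simp: f_def)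
      ultimately obtain d where d: "d > 0" "\<And>h. 0 < h \<Longrightarrow> h < d \<Longrightarrow>
          norm (integral (cbox x (x + h *\<^sub>R One)) f /\<^sub>R h ^ DIM('a) - f x) < \<bar>g x\<bar>"
        using N(2)[OF x(2), of "\<bar>g x\<bar>"] by auto
      obtain r where r: "r > 0" "ball x r \<subseteq> box a b"
        using x(1) open_box open_contains_ball by blast
      \<comment> \<open>An edge length below \<open>q\<close> puts the opposite corner
        \<open>x + h *\<^sub>R One\<close> into the ball of radius \<open>r\<close>, hence the cube
        into the box; the halving in \<open>h\<close> makes the bounds by \<open>d\<close> and
        \<open>q\<close> strict.\<close>
      define q where "q = r / (1 + norm (One::'a))"
      define h where "h = min d q / 2"
      have pos: "0 < 1 + norm (One::'a)"
        by (simp add: add_pos_nonneg)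
      then have "0 < q"
        using r(1) by (simp add: q_def)
      with d(1) have h: "0 < h" "h < d" "h < q"
        unfolding h_def by linarith+
      have "h * (1 + norm (One::'a)) < r"
        using h(3) pos unfolding q_def by (simp only: pos_less_divide_eq)
      with h(1) have h3: "h * norm (One::'a) < r"
        by (simp add: distrib_left)
      have "cbox x (x + h *\<^sub>R One) \<subseteq> cbox a b"
      proof -
        have "dist x (x + h *\<^sub>R One) < r"
          using h(1) h3 by (simp add: dist_norm)
        then have "x + h *\<^sub>R One \<in> box a b"
          using r(2) by auto
        with x(1) show ?thesis
          by (auto simp: mem_box) (meson less_imp_le order_trans)+
      qed
      then have "integral (cbox x (x + h *\<^sub>R One)) f = integral (cbox x (x + h *\<^sub>R One)) g"
        by (intro integral_cong) (auto simp: f_def)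
      also have "\<dots> = 0"
        using \<open>cbox x (x + h *\<^sub>R One) \<subseteq> cbox a b\<close> ab
        by (intro integral_cbox_eq_0_if_test[OF loc test]) auto
      finally show False
        using d(2)[OF h(1,2)] fx by simp
    qed
    then have "{x. \<not> (x \<in> cbox a b \<longrightarrow> g x = 0)} \<subseteq> N \<union> (cbox a b - box a b)"
      by blast
    moreover have "N \<union> (cbox a b - box a b) \<in> null_sets lebesgue"
      using N(1) negligible_frontier_interval[of a b] negligible_iff_null_sets by blast
    ultimately show ?thesis
      by (intro AE_I') simp_all
  qed
  obtain \<D> where \<D>: "countable \<D>" "\<D> \<subseteq> Pow U" "\<And>S. S \<in> \<D> \<Longrightarrow> \<exists>a b. S = cbox a b" "\<Union>\<D> = U"
    using open_countable_Union_open_cbox[OF \<open>open U\<close>] by metis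
  have "AE x in lebesgue. \<forall>S\<in>\<D>. x \<in> S \<longrightarrow> g x = 0"
    using \<D>(1)
  proof (rule AE_ball_countable[THEN iffD2], intro ballI)
    fix S assume "S \<in> \<D>"
    with \<D>(2,3) on_cbox show "AE x in lebesgue. x \<in> S \<longrightarrow> g x = 0"
      by (metis PowD subsetD)
  qed
  then show ?thesis
    by (rule AE_mp) (use \<D>(4) in auto)
qed

section \<open>Integration by parts\<close>

lemma integrable_continuous_compact_support:
  fixes f :: "'a::euclidean_space \<Rightarrow> 'b::euclidean_space"
  assumes "continuous_on UNIV f" "compact K" "\<And>x. x \<notin> K \<Longrightarrow> f x = 0"
  shows "integrable lborel f"
proof -
  have "integrable lborel (\<lambda>x. indicator K x *\<^sub>R f x)"
    using assms by (intro borel_integrable_compact) (auto intro: continuous_on_subset)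
  moreover have "indicator K x *\<^sub>R f x = f x" for x
    using assms(3)[of x] by (auto simp: indicator_def)
  ultimately show ?thesis by simp
qed

text \<open>Translation invariance makes the integral of every difference quotient vanish.\<close>

lemma integral_directional_derivative_compact_support:
  fixes u :: "'a::euclidean_space \<Rightarrow> real"
  assumes der: "\<And>x. (u has_derivative u' x) (at x)"
    and cont: "continuous_on UNIV (\<lambda>x. u' x v)"
    and K: "compact K" "\<And>x. x \<notin> K \<Longrightarrow> u x = 0"
  shows "(LINT x|lborel. u' x v) = 0"
proof -
  have u_cont: "continuous_on UNIV u"
    using der by (meson has_derivative_at_withinI has_derivative_continuous_on)
  have u_meas [measurable]: "u \<in> borel_measurable borel"
    by (rule borel_measurable_continuous_onI[OF u_cont])
  have u_int: "integrable lborel u"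
    using integrable_continuous_compact_support[OF u_cont K] .
  have der_0: "u' x v = 0" if "x \<notin> K" for x
  proof -
    have "(u has_derivative (\<lambda>h. 0)) (at x)"
      by (rule has_derivative_transform_within_open[of "\<lambda>x. 0" _ _ _ "- K"])
        (use that K in \<open>auto simp: compact_imp_closed\<close>)
    with der[of x] show ?thesis
      by (metis has_derivative_unique)
  qed
  obtain B where B: "\<And>x. \<bar>u' x v\<bar> \<le> B"
  proof -
    have "bounded ((\<lambda>x. u' x v) ` K)"
      using K(1) cont by (meson compact_continuous_image compact_imp_bounded continuous_on_subset subset_UNIV)
    then obtain B where "B > 0" "\<And>x. x \<in> K \<Longrightarrow> \<bar>u' x v\<bar> \<le> B"
      by (auto simp: bounded_pos)
    with der_0 that[of B] show thesis
      by (metis abs_zero less_eq_real_def)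
  qed
  \<comment> \<open>\<open>K'\<close> is swept out by \<open>K\<close> moving along
    \<open>- v\<close> for times up to 1. It contains the support of every difference quotient
    \<open>D n\<close>, so \<open>B\<close> times its indicator is a common integrable
    bound.\<close>
  define K' where "K' = (\<lambda>(x, s). x - s *\<^sub>R v) ` (K \<times> {0..1::real})"
  have "compact K'"
    unfolding K'_def using K(1)
    by (intro compact_continuous_image compact_Times)
      (auto simp: case_prod_unfold intro!: continuous_intros)
  have mem_K': "x + s *\<^sub>R v \<in> K \<Longrightarrow> 0 \<le> s \<Longrightarrow> s \<le> 1 \<Longrightarrow> x \<in> K'" for x s
    unfolding K'_def by (rule image_eqI[of _ _ "(x + s *\<^sub>R v, s)"]) simp_all
  have line: "((\<lambda>s. u (x + s *\<^sub>R v)) has_real_derivative u' (x + s *\<^sub>R v) v) (at s)" for x s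
  proof -
    interpret bounded_linear "u' (x + s *\<^sub>R v)"
      using der by (rule has_derivative_bounded_linear)
    have "((\<lambda>s. x + s *\<^sub>R v) has_derivative (\<lambda>h. h *\<^sub>R v)) (at s)"
      by (auto intro!: derivative_eq_intros)
    from has_derivative_compose[OF this der]
    show ?thesis
      by (simp add: has_field_derivative_def scaleR mult_commute_abs)
  qed
  define t where "t n = inverse (real (Suc n))" for n
  have t: "0 < t n" "t n \<le> 1" for n
    by (auto simp: t_def field_simps)
  define D where "D n x = (u (x + t n *\<^sub>R v) - u x) / t n" for n x
  have "(\<lambda>n. LINT x|lborel. D n x) \<longlonglongrightarrow> (LINT x|lborel. u' x v)"
  proof (rule integral_dominated_convergence[where w="\<lambda>x. indicator K' x *\<^sub>R B"])
    show "(\<lambda>x. u' x v) \<in> borel_measurable lborel"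
      using cont borel_measurable_continuous_onI by simp
    show "D n \<in> borel_measurable lborel" for n
      unfolding D_def by measurable
    show "integrable lborel (\<lambda>x. indicator K' x *\<^sub>R B)"
      using \<open>compact K'\<close> by (intro borel_integrable_compact) auto
    have "(\<lambda>n. D n x) \<longlonglongrightarrow> u' x v" for x
    proof -
      have "((\<lambda>h. (u (x + h *\<^sub>R v) - u x) / h) \<longlongrightarrow> u' x v) (at 0)"
        using line[of x 0] by (simp add: DERIV_def)
      moreover have "filterlim t (at 0) sequentially"
        unfolding filterlim_at using LIMSEQ_inverse_real_of_nat by (simp add: t_def[abs_def])
      ultimately show ?thesis
        unfolding D_def by (rule filterlim_compose)
    qed
    then show "AE x in lborel. (\<lambda>n. D n x) \<longlonglongrightarrow> u' x v"
      by simp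
    have "norm (D n x) \<le> indicator K' x *\<^sub>R B" for n x
    proof (cases "x \<in> K'")
      case True
      obtain z where "u (x + t n *\<^sub>R v) - u (x + 0 *\<^sub>R v) = (t n - 0) * u' (x + z *\<^sub>R v) v"
        using MVT2[OF t(1)[of n] line[of x]] by blast
      \<comment> \<open>By the mean value theorem the quotient is a value of the directional
        derivative, hence bounded by \<open>B\<close>.\<close>
      then have "D n x = u' (x + z *\<^sub>R v) v"
        using t(1)[of n] by (simp add: D_def)
      with True B show ?thesis by simp
    next
      case False
      then have "x + 0 *\<^sub>R v \<notin> K" "x + t n *\<^sub>R v \<notin> K"
        using mem_K' t[of n] by (metis order_refl zero_le_one, metis less_imp_le)
      with K(2) False show ?thesis by (simp add: D_def)
    qed
    then show "AE x in lborel. norm (D n x) \<le> indicator K' x *\<^sub>R B" for n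
      by simp
  qed
  moreover have "(LINT x|lborel. D n x) = 0" for n
  proof -
    let ?c = "t n *\<^sub>R v"
    have "integrable (distr lborel borel ((+) ?c)) u"
      using u_int by (simp add: lborel_distr_plus)
    then have "integrable lborel (\<lambda>x. u (?c + x))"
      by (subst (asm) integrable_distr_eq) (use u_meas in simp_all)
    moreover have "(LINT x|lborel. u (?c + x)) = (LINT x|distr lborel borel ((+) ?c). u x)"
      by (subst integral_distr) (use u_meas in simp_all)
    ultimately show ?thesis
      using u_int by (simp add: D_def lborel_distr_plus add.commute)
  qed
  ultimately show ?thesis
    by (simp add: LIMSEQ_const_iff)
qed

lemma C_c_infinityE:
  fixes \<psi> :: "'a::euclidean_space \<Rightarrow> real"
  assumes "\<psi> \<in> C_c_infinity U"
  obtains K \<psi>' where "compact K" "K \<subseteq> U" "\<forall>x. x \<notin> K \<longrightarrow> \<psi> x = 0" "continuous_on UNIV \<psi>"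
    "\<forall>x. (\<psi> has_derivative \<psi>' x) (at x)" "\<forall>v. continuous_on UNIV (\<lambda>x. \<psi>' x v)"
proof -
  have \<psi>: "C_order 1 \<psi>" "compact (closure {x. \<psi> x \<noteq> 0})" "closure {x. \<psi> x \<noteq> 0} \<subseteq> U"
    using assms by (auto simp: C_c_infinity_def)
  then obtain \<psi>' where "\<And>x. (\<psi> has_derivative \<psi>' x) (at x)" "\<And>v. continuous_on UNIV (\<lambda>x. \<psi>' x v)"
    by auto
  moreover have "\<psi> x = 0" if "x \<notin> closure {x. \<psi> x \<noteq> 0}" for x
    using that closure_subset[of "{x. \<psi> x \<noteq> 0}"] by blast
  ultimately show thesis
    using that \<psi> C_order_continuous by blast
qed

text \<open>A test function is bounded, measurable and zero off a compact subset of
  \<open>U\<close>, on which \<open>g\<close> is integrable.\<close>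

lemma set_integrable_times_test_function:
  fixes g :: "'a::euclidean_space \<Rightarrow> real"
  assumes "locally_integrable U g" "\<psi> \<in> C_c_infinity U"
  shows "set_integrable lebesgue U (\<lambda>x. g x * \<psi> x)"
proof -
  obtain K where K: "compact K" "K \<subseteq> U" "\<And>x. x \<notin> K \<Longrightarrow> \<psi> x = 0"
    and cont: "continuous_on UNIV \<psi>"
    using C_c_infinityE[OF assms(2)] by metis
  have "bounded (\<psi> ` K)"
    using K(1) cont by (meson compact_continuous_image compact_imp_bounded continuous_on_subset subset_UNIV)
  moreover have "\<psi> \<in> borel_measurable (lebesgue_on K)"
    using K(1) cont by (intro continuous_imp_measurable_on_sets_lebesgue)
      (auto intro: continuous_on_subset simp: compact_imp_closed)
  moreover have "set_integrable lebesgue K g"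
    using assms(1) K by (simp add: locally_integrable_def)
  ultimately have "set_integrable lebesgue K (\<lambda>x. \<psi> x * g x)"
    using K(1) by (intro absolutely_integrable_bounded_measurable_product[OF bilinear_times])
      (auto simp: compact_imp_closed)
  moreover have "(\<lambda>x. indicator K x *\<^sub>R (\<psi> x * g x)) = (\<lambda>x. indicator U x *\<^sub>R (g x * \<psi> x))"
    using K(2,3) by (auto simp: indicator_def fun_eq_iff)
  ultimately show ?thesis
    unfolding set_integrable_def by simp
qed

text \<open>The product of \<open>f\<close> and \<open>\<psi>\<close> has compact support, so its
  directional derivative integrates to zero; the product rule splits this integral. As
  \<open>\<psi>\<close> is supported in \<open>U\<close>, integrals over \<open>U\<close> and over
  the whole space agree.\<close>

lemma integration_by_parts_test_function:
  fixes f \<psi> :: "'a::euclidean_space \<Rightarrow> real"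
  assumes der: "\<And>x. (f has_derivative f' x) (at x)"
    and cont: "continuous_on UNIV (\<lambda>x. f' x v)"
    and \<psi>: "\<psi> \<in> C_c_infinity U"
  shows "(LINT x:U|lebesgue. f x * frechet_derivative \<psi> (at x) v) = - (LINT x:U|lebesgue. f' x v * \<psi> x)"
proof -
  obtain K \<psi>' where K: "compact K" "K \<subseteq> U" "\<And>x. x \<notin> K \<Longrightarrow> \<psi> x = 0"
    and \<psi>_cont: "continuous_on UNIV \<psi>"
    and \<psi>': "\<And>x. (\<psi> has_derivative \<psi>' x) (at x)" "\<And>v. continuous_on UNIV (\<lambda>x. \<psi>' x v)"
    using C_c_infinityE[OF \<psi>] by metis
  have f_cont: "continuous_on UNIV f"
    using der by (meson has_derivative_at_withinI has_derivative_continuous_on)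
  have \<psi>'_0: "\<psi>' x v = 0" if "x \<notin> K" for x
  proof -
    have "(\<psi> has_derivative (\<lambda>h. 0)) (at x)"
      by (rule has_derivative_transform_within_open[of "\<lambda>x. 0" _ _ _ "- K"])
        (use that K in \<open>auto simp: compact_imp_closed\<close>)
    with \<psi>'(1)[of x] show ?thesis
      by (metis has_derivative_unique)
  qed
  have c1: "continuous_on UNIV (\<lambda>x. f x * \<psi>' x v)" and c2: "continuous_on UNIV (\<lambda>x. f' x v * \<psi> x)"
    by (intro continuous_intros f_cont \<psi>' cont \<psi>_cont)+
  have i1: "integrable lborel (\<lambda>x. f x * \<psi>' x v)" and i2: "integrable lborel (\<lambda>x. f' x v * \<psi> x)"
    using integrable_continuous_compact_support[OF c1 K(1)]
      integrable_continuous_compact_support[OF c2 K(1)] K(3) \<psi>'_0 by auto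
  have "(LINT x|lborel. f x * \<psi>' x v + f' x v * \<psi> x) = 0"
    by (rule integral_directional_derivative_compact_support[where u="\<lambda>x. f x * \<psi> x"
          and u'="\<lambda>x h. f x * \<psi>' x h + f' x h * \<psi> x", OF _ _ K(1)])
      (use K(3) in \<open>auto intro!: has_derivative_mult der \<psi>' continuous_on_add c1 c2\<close>)
  then have "(LINT x|lborel. f x * \<psi>' x v) = - (LINT x|lborel. f' x v * \<psi> x)"
    using i1 i2 by simp
  moreover have "(LINT x:U|lebesgue. f x * frechet_derivative \<psi> (at x) v) = (LINT x|lborel. f x * \<psi>' x v)"
  proof -
    have "(\<lambda>x. indicator U x *\<^sub>R (f x * frechet_derivative \<psi> (at x) v)) = (\<lambda>x. f x * \<psi>' x v)"
      using frechet_derivative_at[OF \<psi>'(1)] \<psi>'_0 K(2) by (auto simp: indicator_def fun_eq_iff)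
    with i1 show ?thesis
      unfolding set_lebesgue_integral_def by (simp add: integral_completion)
  qed
  moreover have "(LINT x:U|lebesgue. f' x v * \<psi> x) = (LINT x|lborel. f' x v * \<psi> x)"
  proof -
    have "(\<lambda>x. indicator U x *\<^sub>R (f' x v * \<psi> x)) = (\<lambda>x. f' x v * \<psi> x)"
      using K(2,3) by (auto simp: indicator_def fun_eq_iff)
    with i2 show ?thesis
      unfolding set_lebesgue_integral_def by (simp add: integral_completion)
  qed
  ultimately show ?thesis by simp
qed

section \<open>Weak Jacobians\<close>

lemma locally_integrable_continuous:
  assumes "continuous_on UNIV f"
  shows "locally_integrable U f"
  unfolding locally_integrable_def set_integrable_def
proof (intro allI impI)
  fix K assume "compact K \<and> K \<subseteq> U"
  then have "integrable lborel (\<lambda>x. indicator K x *\<^sub>R f x)"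
    using assms by (intro borel_integrable_compact) (auto intro: continuous_on_subset)
  then show "integrable lebesgue (\<lambda>x. indicator K x *\<^sub>R f x)"
    by (subst integrable_completion) auto
qed

text \<open>The entry \<open>(i, j)\<close> of the classical Jacobian is the derivative of component
  \<open>i\<close> along \<open>axis j 1\<close>, so integration by parts applies entry by
  entry.\<close>

lemma weak_jacobian_C1:
  fixes F :: "real^'n \<Rightarrow> real^'n"
  assumes der: "\<And>x. (F has_derivative (\<lambda>h. A x *v h)) (at x)" and A: "continuous_on UNIV A"
  shows "weak_jacobian U F A"
  unfolding weak_jacobian_def
proof (intro conjI ballI allI)
  show "locally_integrable U F"
    using der by (meson locally_integrable_continuous has_derivative_at_withinI has_derivative_continuous_on)
  show "locally_integrable U A"
    by (rule locally_integrable_continuous[OF A])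
  fix \<psi> :: "real^'n \<Rightarrow> real" and i j assume \<psi>: "\<psi> \<in> C_c_infinity U"
  have "((\<lambda>x. F x $ i) has_derivative (\<lambda>h. (A x *v h) $ i)) (at x)" for x
    by (rule has_derivative_compose[OF der bounded_linear_imp_has_derivative, of "\<lambda>v. v $ i"])
      (rule bounded_linear_vec_nth)
  moreover have "(A x *v axis j 1) $ i = A x $ i $ j" for x
    by (simp add: matrix_vector_mul_component inner_axis)
  ultimately show "(LINT x:U|lebesgue. F x $ i * frechet_derivative \<psi> (at x) (axis j 1)) =
      - (LINT x:U|lebesgue. A x $ i $ j * \<psi> x)"
    using integration_by_parts_test_function[of "\<lambda>x. F x $ i" "\<lambda>x h. (A x *v h) $ i" "axis j 1" \<psi> U] A \<psi>
    by (simp add: continuous_on_component)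
qed

text \<open>Fields from the kernel space are controlled only on \<open>X\<close>; this lets them be
  replaced by a globally C1 field with the same values there.\<close>

lemma weak_jacobian_cong:
  assumes "\<And>x. x \<in> U \<Longrightarrow> F x = F' x" "weak_jacobian U F G"
  shows "weak_jacobian U F' G"
proof -
  have "set_integrable lebesgue K F = set_integrable lebesgue K F'" if "K \<subseteq> U" for K
    using that assms(1) by (intro set_integrable_cong) auto
  moreover have "(LINT x:U|lebesgue. F x $ i * h x) = (LINT x:U|lebesgue. F' x $ i * h x)" for i h
    unfolding set_lebesgue_integral_def
    by (rule Bochner_Integration.integral_cong) (auto simp: indicator_def assms(1))
  ultimately show ?thesis
    using assms(2) unfolding weak_jacobian_def locally_integrable_def by simp
qed

lemma locally_integrable_entry:
  fixes G :: "'a::euclidean_space \<Rightarrow> real^'m^'n"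
  assumes "locally_integrable U G"
  shows "locally_integrable U (\<lambda>x. G x $ i $ j)"
  unfolding locally_integrable_def set_integrable_def
proof (intro allI impI)
  fix K assume "compact K \<and> K \<subseteq> U"
  with assms have "integrable lebesgue (\<lambda>x. indicator K x *\<^sub>R G x)"
    by (simp add: locally_integrable_def set_integrable_def)
  then have "integrable lebesgue (\<lambda>x. (indicator K x *\<^sub>R G x) $ i $ j)"
    by (intro integrable_bounded_linear[OF bounded_linear_vec_nth])
  then show "integrable lebesgue (\<lambda>x. indicator K x *\<^sub>R G x $ i $ j)"
    by simp
qed

lemma locally_integrable_diff:
  assumes "locally_integrable U f" "locally_integrable U g"
  shows "locally_integrable U (\<lambda>x. f x - g x)"
  using assms unfolding locally_integrable_def by (auto intro: set_integral_diff(1))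

text \<open>The defining identity fixes the integral of each entry against each test function, so
  the fundamental lemma applies to the entries of the difference.\<close>

lemma weak_jacobian_unique:
  assumes "open U" and G: "weak_jacobian U F G" and H: "weak_jacobian U F H"
  shows "AE x in lebesgue. x \<in> U \<longrightarrow> G x = H x"
proof -
  have "AE x in lebesgue. x \<in> U \<longrightarrow> G x $ i $ j - H x $ i $ j = 0" for i j
  proof (rule fundamental_lemma_calculus_of_variations[OF \<open>open U\<close>])
    have loc: "locally_integrable U (\<lambda>x. G x $ i $ j)" "locally_integrable U (\<lambda>x. H x $ i $ j)"
      using G H by (auto simp: weak_jacobian_def intro: locally_integrable_entry)
    then show "locally_integrable U (\<lambda>x. G x $ i $ j - H x $ i $ j)"
      by (rule locally_integrable_diff)
    fix \<psi> :: "real^'a \<Rightarrow> real" assume \<psi>: "\<psi> \<in> C_c_infinity U"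
    have "(LINT x:U|lebesgue. M x $ i $ j * \<psi> x) =
        - (LINT x:U|lebesgue. F x $ i * frechet_derivative \<psi> (at x) (axis j 1))"
      if "weak_jacobian U F M" for M
      using that \<psi> unfolding weak_jacobian_def by simp
    from this[OF G] this[OF H]
    have "(LINT x:U|lebesgue. G x $ i $ j * \<psi> x) = (LINT x:U|lebesgue. H x $ i $ j * \<psi> x)"
      by simp
    then show "(LINT x:U|lebesgue. (G x $ i $ j - H x $ i $ j) * \<psi> x) = 0"
      using set_integral_diff(2)[OF loc[THEN set_integrable_times_test_function[OF _ \<psi>]]]
      by (simp add: left_diff_distrib)
  qed
  then have "AE x in lebesgue. \<forall>i j. x \<in> U \<longrightarrow> G x $ i $ j - H x $ i $ j = 0"
    unfolding AE_all_countable by blast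
  then show ?thesis
    by (rule AE_mp) (auto simp: vec_eq_iff)
qed

section \<open>Uniqueness of the derivative relative to a measurable set\<close>

text \<open>The translates of the set by small multiples of \<open>v\<close> are disjoint and lie in a bounded set.\<close>

lemma negligible_isolated_in_direction_compact:
  fixes K :: "'a::euclidean_space set"
  assumes K: "compact K" and "e > 0"
  shows "negligible {x \<in> K. \<forall>d. 0 < \<bar>d\<bar> \<and> \<bar>d\<bar> < e \<longrightarrow> x + d *\<^sub>R v \<notin> K}" (is "negligible ?N")
proof -
  \<comment> \<open>The compact sets \<open>D n\<close> exhaust the displacements with
    \<open>0 < \<bar>d\<bar> < e\<close>, and \<open>A n\<close> collects the points that a
    displacement from \<open>D n\<close> moves into \<open>K\<close>. So the set in question is
    \<open>K\<close> minus countably many compact sets, hence measurable.\<close>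
  define D where "D n = {d::real. inverse (real (Suc n)) \<le> \<bar>d\<bar>} \<inter> {d. \<bar>d\<bar> \<le> e - inverse (real (Suc n))}" for n
  define A where "A n = (\<lambda>(y, d). y - d *\<^sub>R v) ` (K \<times> D n)" for n
  have D_bound: "0 < \<bar>d\<bar> \<and> \<bar>d\<bar> < e" if "d \<in> D n" for d n
  proof -
    have "inverse (real (Suc n)) > 0" by simp
    with that show ?thesis
      unfolding D_def Int_iff mem_Collect_eq by linarith
  qed
  have "closed (D n)" for n
    unfolding D_def by (intro closed_Int closed_Collect_le continuous_intros)
  moreover have "D n \<subseteq> cball 0 e" for n
    using D_bound by force
  ultimately have "compact (D n)" for n
    by (meson bounded_cball bounded_subset compact_eq_bounded_closed)
  then have "compact (A n)" for n
    unfolding A_def using K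
    by (intro compact_continuous_image compact_Times) (auto simp: case_prod_unfold intro!: continuous_intros)
  moreover have "?N = K - (\<Union>n. A n)"
  proof (intro set_eqI iffI)
    fix x assume "x \<in> ?N"
    moreover have False if "y \<in> K" "d \<in> D n" "x = y - d *\<^sub>R v" "x \<in> ?N" for y d n
      using D_bound[OF that(2)] that by auto
    ultimately show "x \<in> K - (\<Union>n. A n)"
      unfolding A_def by auto
  next
    fix x assume x: "x \<in> K - (\<Union>n. A n)"
    have "x + d *\<^sub>R v \<notin> K" if d: "0 < \<bar>d\<bar>" "\<bar>d\<bar> < e" for d
    proof
      assume "x + d *\<^sub>R v \<in> K"
      obtain n where "inverse (real (Suc n)) < min \<bar>d\<bar> (e - \<bar>d\<bar>)"
        using reals_Archimedean[of "min \<bar>d\<bar> (e - \<bar>d\<bar>)"] d by auto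
      then have "d \<in> D n" by (auto simp: D_def)
      with \<open>x + d *\<^sub>R v \<in> K\<close> have "x \<in> A n"
        unfolding A_def by (force intro!: image_eqI[of _ _ "(x + d *\<^sub>R v, d)"])
      with x show False by blast
    qed
    with x show "x \<in> ?N" by blast
  qed
  ultimately have N: "?N \<in> lmeasurable"
    using K by (auto intro!: fmeasurable.Diff sets.countable_UN simp: lmeasurable_compact compact_imp_closed
        fmeasurable_Diff)
  \<comment> \<open>Distinct shifts in \<open>(0, e]\<close> differ by less than \<open>e\<close>.
    If two translates met, a point of the set would reach another point of \<open>K\<close> by a
    forbidden displacement.\<close>
  define t where "t k = e * inverse (real (Suc k))" for k :: nat
  define T where "T k = (+) (t k *\<^sub>R v) ` ?N" for k
  define B where "B = (\<lambda>(x, s). s *\<^sub>R v + x) ` (K \<times> {0..e})"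
  have t: "0 < t k" "t k \<le> e" for k
    using \<open>e > 0\<close> by (auto simp: t_def field_simps)
  have "compact B"
    unfolding B_def using K
    by (intro compact_continuous_image compact_Times) (auto simp: case_prod_unfold intro!: continuous_intros)
  have T_sub: "T k \<subseteq> B" for k
    unfolding T_def B_def using t[of k] by (force intro: less_imp_le)
  have T_meas: "T k \<in> lmeasurable" "measure lebesgue (T k) = measure lebesgue ?N" for k
    unfolding T_def using N by (auto intro: measurable_translation simp: measure_translation)
  have disj: "T j \<inter> T k = {}" if "j \<noteq> k" for j k
  proof (rule ccontr)
    assume "T j \<inter> T k \<noteq> {}"
    then obtain x y where xy: "x \<in> ?N" "y \<in> ?N" "t j *\<^sub>R v + x = t k *\<^sub>R v + y"
      unfolding T_def by blast
    have "t j \<noteq> t k" using that \<open>e > 0\<close> by (auto simp: t_def)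
    moreover have "\<bar>t j - t k\<bar> < e" using t[of j] t[of k] by linarith
    moreover have "x + (t j - t k) *\<^sub>R v = y"
      using xy(3) by (simp add: algebra_simps)
    ultimately show False
      using xy(1,2) by (metis (no_types, lifting) mem_Collect_eq right_minus_eq zero_less_abs_iff)
  qed
  \<comment> \<open>Any number of disjoint copies of equal measure fit into \<open>B\<close>, which
    has finite measure, so that measure is zero.\<close>
  have "real n * measure lebesgue ?N \<le> measure lebesgue B" for n
  proof -
    have "real n * measure lebesgue ?N = (\<Sum>k<n. measure lebesgue (T k))"
      by (simp add: T_meas)
    also have "\<dots> = measure lebesgue (\<Union>k<n. T k)"
      by (intro measure_UNION'[symmetric]) (auto simp: T_meas pairwise_def disjnt_def disj)
    also have "\<dots> \<le> measure lebesgue B"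
      using \<open>compact B\<close> T_meas(1) T_sub
      by (intro measure_mono_fmeasurable) (auto simp: lmeasurable_compact intro!: sets.finite_UN)
    finally show ?thesis .
  qed
  then have "measure lebesgue ?N = 0"
    by (meson measure_nonneg reals_Archimedean3 less_eq_real_def not_less)
  with N show ?thesis
    by (simp add: negligible_iff_measure)
qed

text \<open>Up to a null set, \<open>X\<close> is a countable union of compact sets
  \<open>F m\<close>. A point isolated in \<open>X\<close> along \<open>v\<close> is isolated in
  each \<open>F m\<close> containing it, and the radius can be shrunk to some
  \<open>inverse (Suc n)\<close>; this leaves countably many instances of the compact case.\<close>

lemma negligible_isolated_in_direction:
  fixes X :: "'a::euclidean_space set"
  assumes "X \<in> sets lebesgue"
  shows "negligible {x \<in> X. \<exists>e>0. \<forall>d. 0 < \<bar>d\<bar> \<and> \<bar>d\<bar> < e \<longrightarrow> x + d *\<^sub>R v \<notin> X}" (is "negligible ?N")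
proof -
  obtain C T where C: "fsigma C" "T \<in> null_sets lebesgue" "C \<union> T = X"
    using lebesgue_set_almost_fsigma[OF assms] by metis
  obtain F :: "nat \<Rightarrow> 'a set" where F: "range F \<subseteq> Collect compact" "C = \<Union>(range F)"
    using C(1) fsigma_Union_compact by metis
  define N where "N m n = {x \<in> F m. \<forall>d. 0 < \<bar>d\<bar> \<and> \<bar>d\<bar> < inverse (real (Suc n)) \<longrightarrow> x + d *\<^sub>R v \<notin> F m}" for m n
  have "?N \<subseteq> T \<union> (\<Union>m n. N m n)"
  proof
    fix x assume "x \<in> ?N"
    then obtain e where x: "x \<in> X" and e: "e > 0" "\<And>d. 0 < \<bar>d\<bar> \<Longrightarrow> \<bar>d\<bar> < e \<Longrightarrow> x + d *\<^sub>R v \<notin> X"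
      by blast
    obtain n where n: "inverse (real (Suc n)) < e"
      using reals_Archimedean[OF e(1)] by blast
    show "x \<in> T \<union> (\<Union>m n. N m n)"
    proof (cases "x \<in> T")
      case False
      then obtain m where "x \<in> F m" using x C(3) F(2) by blast
      moreover have "F m \<subseteq> X" using C(3) F(2) by blast
      ultimately have "x \<in> N m n" using e(2) n unfolding N_def by force
      then show ?thesis by blast
    qed simp
  qed
  moreover have "negligible (N m n)" for m n
    unfolding N_def using F(1) by (intro negligible_isolated_in_direction_compact) auto
  then have "negligible (T \<union> (\<Union>m n. N m n))"
    using C(2) by (intro negligible_Un negligible_countable_Union) (auto simp: negligible_iff_null_sets)
  ultimately show ?thesis
    by (rule negligible_subset[rotated])
qed

text \<open>The derivative within \<open>X\<close> is unique at a point that \<open>X\<close>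
  approaches along every coordinate line. Where this fails, the point is isolated in one of finitely
  many basis directions.\<close>

lemma AE_unique_derivative_within:
  fixes X :: "'a::euclidean_space set" and f :: "'a \<Rightarrow> 'b::real_normed_vector"
  assumes "X \<in> sets lebesgue"
  shows "AE x in lebesgue. x \<in> X \<longrightarrow> (\<forall>f' f''. (f has_derivative f') (at x within X) \<longrightarrow>
    (f has_derivative f'') (at x within X) \<longrightarrow> f' = f'')"
proof (rule AE_I')
  let ?N = "\<lambda>v. {x \<in> X. \<exists>e>0. \<forall>d. 0 < \<bar>d\<bar> \<and> \<bar>d\<bar> < e \<longrightarrow> x + d *\<^sub>R v \<notin> X}"
  show "(\<Union>v\<in>Basis. ?N v) \<in> null_sets lebesgue"
    using negligible_isolated_in_direction[OF assms]
    by (intro null_sets.finite_UN) (auto simp: negligible_iff_null_sets)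
  show "{x \<in> space lebesgue. \<not> (x \<in> X \<longrightarrow> (\<forall>f' f''. (f has_derivative f') (at x within X) \<longrightarrow>
    (f has_derivative f'') (at x within X) \<longrightarrow> f' = f''))} \<subseteq> (\<Union>v\<in>Basis. ?N v)"
  proof
    fix x assume "x \<in> {x \<in> space lebesgue. \<not> (x \<in> X \<longrightarrow> (\<forall>f' f''. (f has_derivative f') (at x within X) \<longrightarrow>
      (f has_derivative f'') (at x within X) \<longrightarrow> f' = f''))}"
    then obtain f' f'' where x: "x \<in> X" "(f has_derivative f') (at x within X)"
      "(f has_derivative f'') (at x within X)" and "f' \<noteq> f''"
      by blast
    then have "\<exists>i\<in>Basis. \<exists>e>0. \<forall>d. 0 < \<bar>d\<bar> \<and> \<bar>d\<bar> < e \<longrightarrow> x + d *\<^sub>R i \<notin> X"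
      using frechet_derivative_unique_within[OF x(2,3)] by blast
    with x(1) show "x \<in> (\<Union>v\<in>Basis. ?N v)" by blast
  qed
qed

lemma jacobian_on_C1_unique:
  fixes F f :: "real^'n \<Rightarrow> real^'n"
  assumes X: "X \<in> sets lebesgue" and G: "jacobian_on X F G"
    and F: "\<And>x. x \<in> X \<Longrightarrow> F x = f x"
    and f: "\<And>x. (f has_derivative (\<lambda>h. A x *v h)) (at x)" and A: "continuous_on UNIV A"
  shows "AE x in lebesgue. x \<in> X \<longrightarrow> G x = A x"
proof -
  have "weak_jacobian (interior X) f G"
    using G F interior_subset by (auto simp: jacobian_on_def intro: weak_jacobian_cong[of _ F])
  then have "AE x in lebesgue. x \<in> interior X \<longrightarrow> G x = A x"
    using weak_jacobian_C1[OF f A] by (intro weak_jacobian_unique) auto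
  moreover have "AE x in lebesgue. x \<in> X - interior X \<longrightarrow> (F has_derivative (\<lambda>h. G x *v h)) (at x within X)"
    using G by (simp add: jacobian_on_def)
  moreover note AE_unique_derivative_within[OF X, of F]
  ultimately show ?thesis
  proof eventually_elim
    case (elim x)
    show ?case
    proof
      assume x: "x \<in> X"
      \<comment> \<open>A derivative within \<open>X\<close> depends only on the values on
        \<open>X\<close>, so that of \<open>f\<close> carries over to \<open>F\<close>.\<close>
      have "(F has_derivative (\<lambda>h. A x *v h)) (at x within X)"
        by (rule has_derivative_transform[OF x _ has_derivative_at_withinI[OF f]]) (use F in simp)
      with elim x show "G x = A x"
        by (cases "x \<in> interior X") (auto simp: matrix_eq fun_eq_iff)
    qed
  qed
qed

section \<open>The gradient formula\<close>

theorem lemma3p13: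
  fixes D X \<Omega> :: "(real^'n) set"
    and \<Xi> :: "(real^'n) set set"
    and J :: "(real^'n) set \<Rightarrow> real"
    and S1 :: "real^'n \<Rightarrow> real^'n^'n"
    and S0 :: "real^'n \<Rightarrow> real^'n"
    and \<sigma> :: real
    and \<phi> :: "real \<Rightarrow> real"
    and ev :: "'h::{real_inner, complete_space} \<Rightarrow> real^'n \<Rightarrow> real"
    and y :: "real^'n"
  assumes "open D" and "bounded D"
    and "X \<subseteq> closure D" and "X \<in> sets lebesgue"
    and "\<Xi> \<subseteq> Pow D" and "\<Omega> \<in> \<Xi>"
    and "set_integrable lebesgue X S1"
    and "set_integrable lebesgue X S0"
    and "\<And>V. V \<in> C_c_infinity D \<Longrightarrow> has_shape_derivative J \<Xi> \<Omega> V (tensor_form X S1 S0 V)"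
    and "\<sigma> > 0"
    and "\<And>r. \<phi> field_differentiable (at r)" and "continuous_on UNIV (deriv \<phi>)"
    and "function_space_on X ev"
    and "reproducing_kernel_on X ev (\<lambda>x y. rescale \<sigma> \<phi> ((norm (x - y))\<^sup>2))"
    and "\<And>f :: 'h^'n. tensor_form_defined X S1 S0 (vec_eval ev f)"
    and "bounded_linear (\<lambda>f :: 'h^'n. tensor_form X S1 S0 (vec_eval ev f))"
    and "y \<in> X"
  shows "vec_eval ev (gradient (\<lambda>f :: 'h^'n. tensor_form X S1 S0 (vec_eval ev f))) y =
    (LINT x:X|lebesgue. rescale \<sigma> \<phi> ((norm (x - y))\<^sup>2) *\<^sub>R S0 x +
       (2 / \<sigma> * rescale \<sigma> (deriv \<phi>) ((norm (x - y))\<^sup>2)) *\<^sub>R (S1 x *v (x - y)))"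
proof -
  note X = \<open>X \<in> sets lebesgue\<close>
  \<comment> \<open>\<open>k\<close> is the kernel section at \<open>y\<close>, \<open>k'\<close>
    its gradient and \<open>W\<close> the integrand of the claim. The factor
    \<open>2 / \<sigma>\<close> comes from differentiating
    \<open>(norm (x - y))\<^sup>2 / \<sigma>\<close>.\<close>
  define k where "k x = rescale \<sigma> \<phi> ((norm (x - y))\<^sup>2)" for x
  define k' where "k' x = (2 / \<sigma> * rescale \<sigma> (deriv \<phi>) ((norm (x - y))\<^sup>2)) *\<^sub>R (x - y)" for x
  define W where "W x = k x *\<^sub>R S0 x + S1 x *v k' x" for x
  \<comment> \<open>The kernel property gives the section with \<open>y\<close> as first argument;
    symmetry of the norm turns it into \<open>k\<close>.\<close>
  obtain h where h: "\<And>x. x \<in> X \<Longrightarrow> ev h x = k x" and repr: "\<And>f. h \<bullet> f = ev f y"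
    using \<open>reproducing_kernel_on X ev _\<close> \<open>y \<in> X\<close>
    unfolding reproducing_kernel_on_def k_def by (metis norm_minus_commute)
  have k_der: "(k has_derivative (\<lambda>d. k' x \<bullet> d)) (at x)" for x
  proof -
    have "((\<lambda>x. (norm (x - y))\<^sup>2 / \<sigma>) has_derivative (\<lambda>d. 2 * ((x - y) \<bullet> d) / \<sigma>)) (at x)"
      unfolding power2_norm_eq_inner using \<open>\<sigma> > 0\<close>
      by (auto intro!: derivative_eq_intros simp: inner_commute)
    moreover have "(\<phi> has_derivative (*) (deriv \<phi> ((norm (x - y))\<^sup>2 / \<sigma>))) (at ((norm (x - y))\<^sup>2 / \<sigma>))"
      using \<open>\<And>r. \<phi> field_differentiable (at r)\<close> DERIV_deriv_iff_field_differentiable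
      by (metis has_field_derivative_def)
    ultimately have "((\<lambda>x. \<phi> ((norm (x - y))\<^sup>2 / \<sigma>)) has_derivative
        (\<lambda>d. deriv \<phi> ((norm (x - y))\<^sup>2 / \<sigma>) * (2 * ((x - y) \<bullet> d) / \<sigma>))) (at x)"
      by (rule has_derivative_compose)
    then show ?thesis
      unfolding k_def[abs_def] k'_def rescale_def by (simp add: mult_ac)
  qed
  have k_cont: "continuous_on UNIV k"
    using k_der by (meson has_derivative_at_withinI has_derivative_continuous_on)
  have k'_cont: "continuous_on UNIV k'"
    unfolding k'_def rescale_def
    by (intro continuous_intros continuous_on_compose2[OF \<open>continuous_on UNIV (deriv \<phi>)\<close>])
      (use \<open>\<sigma> > 0\<close> in auto)
  \<comment> \<open>\<open>X\<close> lies in the compact closure of \<open>D\<close>, so the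
    continuous \<open>k\<close> and \<open>k'\<close> are bounded on it and products with the
    integrable \<open>S0\<close> and \<open>S1\<close> stay integrable. This allows components to be
    taken under the integral.\<close>
  have W_int: "set_integrable lebesgue X W"
  proof -
    have cpt: "compact (closure D)"
      using \<open>bounded D\<close> by simp
    have bdd: "bounded (f ` X)" if "continuous_on UNIV f" for f :: "real^'n \<Rightarrow> 'b::real_normed_vector"
      using that cpt \<open>X \<subseteq> closure D\<close>
      by (meson bounded_subset compact_continuous_image compact_imp_bounded continuous_on_subset image_mono subset_UNIV)
    have meas: "f \<in> borel_measurable (lebesgue_on X)" if "continuous_on UNIV f" for f :: "real^'n \<Rightarrow> 'b::euclidean_space"
      using that X by (intro continuous_imp_measurable_on_sets_lebesgue) (auto intro: continuous_on_subset)
    have "set_integrable lebesgue X (\<lambda>x. k x *\<^sub>R S0 x)"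
      using meas bdd k_cont X \<open>set_integrable lebesgue X S0\<close>
      by (intro absolutely_integrable_bounded_measurable_product[where h="(*\<^sub>R)"])
        (auto simp: bilinear_conv_bounded_bilinear bounded_bilinear_scaleR)
    moreover have "set_integrable lebesgue X (\<lambda>x. S1 x *v k' x)"
      using meas bdd k'_cont X \<open>set_integrable lebesgue X S1\<close>
      by (intro absolutely_integrable_bounded_measurable_product[where h="\<lambda>v M. M *v v"])
        (auto simp: bilinear_def matrix_vector_mul_linear intro!: linearI matrix_vector_mult_add_rdistrib
           scaleR_matrix_vector_assoc[symmetric])
    ultimately show ?thesis
      unfolding W_def by (rule set_integral_add(1))
  qed
  have component: "tensor_form X S1 S0 (vec_eval ev (axis i h)) = (LINT x:X|lebesgue. W x) $ i" for i
  proof -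
    define F where "F = vec_eval ev (axis i h :: 'h^'n)"
    \<comment> \<open>The classical Jacobian of the field with \<open>k\<close> in slot
      \<open>i\<close>: row \<open>i\<close> is the gradient of \<open>k\<close>, all other rows are
      zero.\<close>
    define A where "A x = (\<chi> a. if a = i then k' x else 0)" for x
    have "continuous_on UNIV (\<lambda>x. if a = i then k' x else 0)" for a
      by (cases "a = i") (simp_all add: k'_cont)
    then have A_cont: "continuous_on UNIV A"
      unfolding A_def by (rule continuous_on_vec_lambda)
    have A_der: "((\<lambda>x. axis i (k x)) has_derivative (\<lambda>d. A x *v d)) (at x)" for x
    proof -
      have "A x *v d = axis i (k' x \<bullet> d)" for d
        by (simp add: A_def vec_eq_iff matrix_vector_mul_component axis_def)
      moreover have "bounded_linear (axis i :: real \<Rightarrow> real^'n)"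
        by (rule linear_conv_bounded_linear[THEN iffD1], rule linearI) (auto simp: axis_def vec_eq_iff)
      from has_derivative_compose[OF k_der bounded_linear_imp_has_derivative[OF this]]
      have "((\<lambda>x. axis i (k x)) has_derivative (\<lambda>d. axis i (k' x \<bullet> d) :: real^'n)) (at x)" .
      ultimately show ?thesis by simp
    qed
    have F: "F x = axis i (k x)" if "x \<in> X" for x
    proof -
      have "linear (\<lambda>f. ev f x)"
        using \<open>function_space_on X ev\<close> that by (simp add: function_space_on_def)
      then have "ev 0 x = 0" by (rule linear_0)
      then show ?thesis
        using h[OF that] by (simp add: F_def vec_eval_def vec_eq_iff axis_def)
    qed
    have F_def_ok: "tensor_form_defined X S1 S0 F"
      unfolding F_def by fact
    \<comment> \<open>Since some Jacobian of \<open>F\<close> exists by assumption, the choice made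
      by \<open>jacobian\<close> is one.\<close>
    then have "jacobian_on X F (jacobian X F)"
      unfolding tensor_form_defined_def jacobian_def by (metis someI_ex)
    then have "AE x in lebesgue. x \<in> X \<longrightarrow> jacobian X F x = A x"
      by (rule jacobian_on_C1_unique[OF X _ F A_der A_cont])
    then have "AE x in lebesgue. x \<in> X \<longrightarrow> tensor_integrand X S1 S0 F x = W x $ i"
    proof eventually_elim
      case (elim x)
      \<comment> \<open>Only row \<open>i\<close> of \<open>A x\<close> survives in the Frobenius
        product, leaving row \<open>i\<close> of \<open>S1 x\<close> times
        \<open>k' x\<close>.\<close>
      have "S1 x \<bullet> A x = (S1 x *v k' x) $ i"
        by (simp add: A_def inner_vec_def[of "S1 x"] if_distrib[of "\<lambda>z. _ \<bullet> z"] matrix_vector_mul_component cong: if_cong)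
      with elim F show ?case
        by (auto simp: tensor_integrand_def W_def inner_axis)
    qed
    moreover have "set_integrable lebesgue X (tensor_integrand X S1 S0 F)"
      using F_def_ok by (simp add: tensor_form_defined_def)
    moreover have "integrable lebesgue (\<lambda>x. indicator X x *\<^sub>R W x $ i)"
      using integrable_bounded_linear[OF bounded_linear_vec_nth W_int[unfolded set_integrable_def], of i] by simp
    ultimately have "tensor_form X S1 S0 F = (LINT x|lebesgue. indicator X x *\<^sub>R W x $ i)"
      unfolding tensor_form_def set_lebesgue_integral_def set_integrable_def
      by (intro integral_cong_AE) (auto elim: eventually_mono simp: indicator_def)
    also have "\<dots> = (LINT x:X|lebesgue. W x) $ i"
      using integral_bounded_linear[OF bounded_linear_vec_nth W_int[unfolded set_integrable_def], of i]
      by (simp add: set_lebesgue_integral_def)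
    finally show ?thesis
      by (simp add: F_def)
  qed
  define g where "g = gradient (\<lambda>f :: 'h^'n. tensor_form X S1 S0 (vec_eval ev f))"
  have "vec_eval ev g y $ i = (LINT x:X|lebesgue. W x) $ i" for i
  proof -
    \<comment> \<open>The inner product with \<open>axis i h\<close> sees only the component
      \<open>g $ i\<close>, and the reproducing property evaluates it at \<open>y\<close>.\<close>
    have "vec_eval ev g y $ i = g \<bullet> axis i h"
      using repr[of "g $ i"] by (simp add: vec_eval_def inner_axis inner_commute)
    also have "\<dots> = tensor_form X S1 S0 (vec_eval ev (axis i h))"
      unfolding g_def by (rule gradient_inner) fact
    finally show ?thesis by (simp add: component)
  qed
  then have "vec_eval ev g y = (LINT x:X|lebesgue. W x)"
    by (simp add: vec_eq_iff)
  moreover have "W x = rescale \<sigma> \<phi> ((norm (x - y))\<^sup>2) *\<^sub>R S0 x +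
       (2 / \<sigma> * rescale \<sigma> (deriv \<phi>) ((norm (x - y))\<^sup>2)) *\<^sub>R (S1 x *v (x - y))" for x
    by (simp add: W_def k_def k'_def matrix_vector_mult_scaleR)
  ultimately show ?thesis
    by (simp add: g_def)
qed

end
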